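(* Assume that the Lieb-Solovej conjecture is true, i.e. that for every real $s\ge 1$ and every $F\in A^2(\Pi^+)$, $$\int_{\Pi^+}|F(x+iy)|^{2s}y^{2s-2}\,dx\,dy\le \frac{\pi^{1-s}}{(2s-1)2^{2s-2}}\left(\int_{\Pi^+}|F(x+iy)|^2\, dx\,dy\right)^s.$$ Then for every $s>1$ and every $z_0\in\Pi^+$, the Bergman kernel function $F(z)=\frac 1\pi (z-\bar z_0)^{-2}$ is a maximizing function of the extremum problem $$\max_{F\in A^2 (\Pi^+),\ F\not \equiv 0} \frac {\int_{\Pi^+} |F(x+iy)|^{2s}y^{2s-2}\,dx\,dy}{\left (\int_{\Pi^+} |F(x+iy)|^2\,dx\,dy \right )^s}.$$
   Context: $\Pi^+=\{x+iy\in\mathbb{C}: y>0\}$ is the upper half-plane. $A^2(\Pi^+)$ is the Bergman space of holomorphic functions $F$ on $\Pi^+$ with $\int_{\Pi^+}|F(x+iy)|^2\,dx\,dy<\infty$. *)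

theory Defs
  imports "HOL-Complex_Analysis.Complex_Analysis"
begin

definition upper_halfplane :: "complex set" where
  "upper_halfplane = {z. 0 < Im z}"

(* Functions are total on complex; only their values on the upper half-plane matter.
   The area measure dx dy is lborel on complex. *)
definition bergman_space :: "(complex \<Rightarrow> complex) set" where
  "bergman_space =
     {F. F holomorphic_on upper_halfplane \<and>
         set_integrable lborel upper_halfplane (\<lambda>z. (cmod (F z))\<^sup>2)}"

definition bergman_norm_sq :: "(complex \<Rightarrow> complex) \<Rightarrow> real" where
  "bergman_norm_sq F = (LINT z:upper_halfplane|lborel. (cmod (F z))\<^sup>2)"

(* Taken in [0,\<infinity>], so that finiteness is part of the conjectured inequality below;
   the Bochner integral would silently be 0 for a divergent integral. *)
definition weighted_integral :: "real \<Rightarrow> (complex \<Rightarrow> complex) \<Rightarrow> ennreal" where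
  "weighted_integral s F =
     (\<integral>\<^sup>+z\<in>upper_halfplane.
        ennreal (cmod (F z) powr (2 * s) * Im z powr (2 * s - 2)) \<partial>lborel)"

definition lieb_solovej_conjecture :: bool where
  "lieb_solovej_conjecture \<longleftrightarrow>
     (\<forall>s::real. s \<ge> 1 \<longrightarrow> (\<forall>F\<in>bergman_space.
        weighted_integral s F \<le>
          ennreal (pi powr (1 - s) / ((2 * s - 1) * 2 powr (2 * s - 2)) *
                   bergman_norm_sq F powr s)))"

definition bergman_quotient :: "real \<Rightarrow> (complex \<Rightarrow> complex) \<Rightarrow> ennreal" where
  "bergman_quotient s F = weighted_integral s F / ennreal (bergman_norm_sq F powr s)"

definition bergman_kernel :: "complex \<Rightarrow> complex \<Rightarrow> complex" where
  "bergman_kernel z\<^sub>0 z = 1 / of_real pi * (z - cnj z\<^sub>0) powi (-2)"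

end

theory Submission imports Defs begin

text \<open>
  The constant in the Lieb-Solovej inequality is the value of the quotient at the Bergman kernel
  function, so the inequality itself is the assertion that no admissible function does better.
  What has to be proved is this value. For \<open>z\<^sub>0 = x\<^sub>0 + i y\<^sub>0\<close> one has
  \<open>\<bar>F(z)\<bar>\<^sup>2 = \<pi>\<^sup>-\<^sup>2 ((x - x\<^sub>0)\<^sup>2 + (y + y\<^sub>0)\<^sup>2)\<^sup>-\<^sup>2\<close>. Rescaling \<open>x\<close> by \<open>y + y\<^sub>0\<close> and then \<open>y\<close> by \<open>y\<^sub>0\<close>
  splits the integral of \<open>\<bar>F\<bar>\<^bsup>2s\<^esup> y\<^bsup>2s-2\<^esup>\<close> into two one-dimensional Beta integrals
  (\<open>nn_integral_horizontal_line\<close>, \<open>nn_integral_vertical_ray\<close>). Their product is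
  \<open>Beta(1/2, 2s - 1/2) Beta(2s - 1, 2s)\<close>, which Legendre's duplication formula turns into the
  elementary expression \<open>\<pi> 2\<^bsup>2-4s\<^esup> / (2s - 1)\<close> (\<open>Beta_half_times_Beta\<close>). The case \<open>s = 1\<close> of the same
  computation shows that the kernel function is square integrable and gives its norm. Numerator
  and denominator both scale like \<open>y\<^sub>0\<^bsup>-2s\<^esup>\<close>, so the quotient does not depend on \<open>z\<^sub>0\<close>.
\<close>

section \<open>Area measure on the complex plane\<close>

lemma lborel_complex_eq_distr_pair:
  "(lborel :: complex measure) = distr (lborel \<Otimes>\<^sub>M lborel) borel (\<lambda>(x, y). Complex x y)"
proof (rule lborel_eqI)
  have C [measurable]: "(\<lambda>(x, y). Complex x y) \<in> borel_measurable (borel :: (real \<times> real) measure)"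
    unfolding Complex_eq case_prod_unfold
    by (intro borel_measurable_continuous_onI continuous_intros)
  fix l u :: complex
  assume le: "\<And>b. b \<in> Basis \<Longrightarrow> l \<bullet> b \<le> u \<bullet> b"
  from le[of 1] le[of \<i>] have le': "Re l \<le> Re u" "Im l \<le> Im u"
    by (auto simp: Basis_complex_def)
  have "(\<lambda>(x, y). Complex x y) -` box l u = {Re l<..<Re u} \<times> {Im l<..<Im u}"
    by (auto simp: in_box_complex_iff)
  then show "emeasure (distr (lborel \<Otimes>\<^sub>M lborel) borel (\<lambda>(x, y). Complex x y)) (box l u)
      = (\<Prod>b\<in>Basis. (u - l) \<bullet> b)"
    using le' C by (subst emeasure_distr)
      (simp_all add: lborel_prod, simp add: lborel.emeasure_pair_measure_Times
        Basis_complex_def ennreal_mult flip: lborel_prod)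
qed simp

lemma nn_integral_lborel_complex:
  fixes f :: "complex \<Rightarrow> ennreal"
  assumes [measurable]: "f \<in> borel_measurable borel"
  shows "(\<integral>\<^sup>+z. f z \<partial>lborel) = (\<integral>\<^sup>+y. (\<integral>\<^sup>+x. f (Complex x y) \<partial>lborel) \<partial>lborel)"
proof -
  have "(\<lambda>(x, y). Complex x y) \<in> borel_measurable (borel :: (real \<times> real) measure)"
    unfolding Complex_eq case_prod_unfold
    by (intro borel_measurable_continuous_onI continuous_intros)
  then have C [measurable]: "(\<lambda>(x, y). Complex x y) \<in> borel_measurable (lborel \<Otimes>\<^sub>M lborel)"
    by (simp add: lborel_prod)
  have "(\<integral>\<^sup>+z. f z \<partial>lborel) = (\<integral>\<^sup>+p. f (case p of (x, y) \<Rightarrow> Complex x y) \<partial>(lborel \<Otimes>\<^sub>M lborel))"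
    by (subst lborel_complex_eq_distr_pair, subst nn_integral_distr) auto
  also have "\<dots> = (\<integral>\<^sup>+y. (\<integral>\<^sup>+x. f (Complex x y) \<partial>lborel) \<partial>lborel)"
    by (subst lborel_pair.nn_integral_snd[symmetric]) auto
  finally show ?thesis .
qed

section \<open>Beta integrals over half-lines and lines\<close>

text \<open>
  For a nonnegative integrand the gauge integral is absolute, so the change of variables theorem
  for absolutely integrable functions becomes a statement about the value of the integral alone.
\<close>
lemma has_integral_substitution_nonneg:
  fixes f g g' :: "real \<Rightarrow> real"
  assumes "S \<in> sets lebesgue"
    and "\<And>x. x \<in> S \<Longrightarrow> (g has_field_derivative g' x) (at x within S)"
    and "inj_on g S"
    and nonneg: "\<And>y. y \<in> g ` S \<Longrightarrow> 0 \<le> f y"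
  shows "((\<lambda>x. \<bar>g' x\<bar> * f (g x)) has_integral I) S \<longleftrightarrow> (f has_integral I) (g ` S)"
proof -
  have abs: "(h has_integral I) A \<longleftrightarrow> h absolutely_integrable_on A \<and> integral A h = I"
    if "\<And>y. y \<in> A \<Longrightarrow> 0 \<le> h y" for h :: "real \<Rightarrow> real" and A
    using that by (auto simp: has_integral_iff set_lebesgue_integral_eq_integral
        intro: nonnegative_absolutely_integrable_1)
  show ?thesis
    using has_absolute_integral_change_of_variables_1'[OF assms(1-3), of f I] nonneg
    by (subst (1 2) abs) auto
qed

lemma Beta_real_nonneg:
  fixes a b :: real
  assumes "a > 0" "b > 0"
  shows "Beta a b \<ge> 0"
  using assms by (simp add: Beta_def less_imp_le Gamma_real_pos add_pos_pos)

text \<open>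
  The substitution \<open>t = u / (1 - u)\<close> carries the unit interval to the half-line and Euler's
  first integral to this one.
\<close>
lemma has_integral_beta_prime:
  fixes a b :: real
  assumes "a > 0" "b > 0"
  shows "((\<lambda>t. t powr (a - 1) * (1 + t) powr (- (a + b))) has_integral Beta a b) {0<..}"
proof -
  let ?f = "\<lambda>t::real. t powr (a - 1) * (1 + t) powr (- (a + b))"
  let ?g = "\<lambda>u::real. u / (1 - u)"
  have img: "?g ` {0<..<1} = {0<..}"
  proof (intro equalityI subsetI)
    fix t :: real assume "t \<in> {0<..}"
    then have "t = ?g (t / (1 + t))" "t / (1 + t) \<in> {0<..<1}"
      by (auto simp: divide_simps)
    then show "t \<in> ?g ` {0<..<1}" by (rule image_eqI)
  qed auto
  have inj: "inj_on ?g {0<..<1}"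
    by (auto simp: inj_on_def divide_simps algebra_simps)
  have der: "(?g has_field_derivative 1 / (1 - u)\<^sup>2) (at u within {0<..<1})"
    if "u \<in> {0<..<1}" for u
    using that by (auto intro!: derivative_eq_intros simp: field_simps power2_eq_square)
  have eq: "\<bar>1 / (1 - u)\<^sup>2\<bar> * ?f (?g u) = u powr (a - 1) * (1 - u) powr (b - 1)"
    if "u \<in> {0<..<1}" for u
  proof -
    have "1 + ?g u = inverse (1 - u)" using that by (simp add: field_simps)
    then have "\<bar>1 / (1 - u)\<^sup>2\<bar> * ?f (?g u) =
        u powr (a - 1) * ((1 - u) powr (-2) * (1 - u) powr (1 - a) * (1 - u) powr (a + b))"
    proof -
      have "(?g u) powr (a - 1) = u powr (a - 1) * (1 - u) powr (1 - a)"
        using that powr_minus_divide[of "1 - u" "a - 1"] by (simp add: powr_divide)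
      moreover have "inverse (1 - u) powr (- (a + b)) = (1 - u) powr (a + b)"
        using that by (simp add: powr_minus inverse_powr flip: minus_add_distrib)
      moreover have "\<bar>1 / (1 - u)\<^sup>2\<bar> = (1 - u) powr (- 2)"
        using that by (simp add: powr_minus divide_inverse)
      ultimately show ?thesis
        using \<open>1 + ?g u = inverse (1 - u)\<close> by (simp only: mult_ac)
    qed
    also have "(1 - u) powr (-2) * (1 - u) powr (1 - a) * (1 - u) powr (a + b) = (1 - u) powr (b - 1)"
      by (simp flip: powr_add)
    finally show ?thesis .
  qed
  have "((\<lambda>u. u powr (a - 1) * (1 - u) powr (b - 1)) has_integral Beta a b) {0<..<1}"
    using has_integral_Beta_real[OF assms] by (simp add: has_integral_Icc_iff_Ioo)
  then have I: "((\<lambda>u. \<bar>1 / (1 - u)\<^sup>2\<bar> * ?f (?g u)) has_integral Beta a b) {0<..<1}"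
    by (rule has_integral_eq[rotated]) (use eq in auto)
  show ?thesis
    using I by (subst (asm) has_integral_substitution_nonneg[OF _ der inj]) (auto simp: img)
qed

text \<open>
  The substitution \<open>t = x\<^sup>2\<close> in the preceding integral gives the integral over the positive
  half-line; the integrand is even.
\<close>
lemma has_integral_cauchy_power:
  fixes r :: real
  assumes "r > 1 / 2"
  shows "((\<lambda>x. (1 + x\<^sup>2) powr (- r)) has_integral Beta (1 / 2) (r - 1 / 2)) UNIV"
proof -
  let ?h = "\<lambda>x::real. (1 + x\<^sup>2) powr (- r)"
  let ?f = "\<lambda>t::real. t powr (1 / 2 - 1) * (1 + t) powr (- (1 / 2 + (r - 1 / 2)))"
  let ?g = "\<lambda>x::real. x\<^sup>2"
  have img: "?g ` {0<..} = {0<..}"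
  proof (intro equalityI subsetI)
    fix t :: real assume "t \<in> {0<..}"
    then have "t = ?g (sqrt t)" "sqrt t \<in> {0<..}" by auto
    then show "t \<in> ?g ` {0<..}" by (rule image_eqI)
  qed auto
  have inj: "inj_on ?g {0<..}" by (auto simp: inj_on_def power2_eq_iff)
  have der: "(?g has_field_derivative 2 * x) (at x within {0<..})" for x
    by (auto intro!: derivative_eq_intros)
  have eq: "\<bar>2 * x\<bar> * ?f (?g x) = 2 * ?h x" if "x \<in> {0<..}" for x
  proof -
    have "(x\<^sup>2) powr (- (1 / 2)) = inverse x"
      using that by (simp add: powr_minus powr_half_sqrt)
    then show ?thesis using that by simp
  qed
  have "(?f has_integral Beta (1 / 2) (r - 1 / 2)) (?g ` {0<..})"
    unfolding img using assms by (intro has_integral_beta_prime) auto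
  then have "((\<lambda>x. \<bar>2 * x\<bar> * ?f (?g x)) has_integral Beta (1 / 2) (r - 1 / 2)) {0<..}"
    by (subst has_integral_substitution_nonneg[OF _ der inj]) auto
  then have "((\<lambda>x. 2 * ?h x) has_integral Beta (1 / 2) (r - 1 / 2)) {0<..}"
    by (rule has_integral_eq[rotated]) (use eq in auto)
  from has_integral_mult_right[OF this, of "1 / 2"]
  have "(?h has_integral Beta (1 / 2) (r - 1 / 2) / 2) {0<..}" by simp
  moreover have "(?h has_integral J) {0<..} \<longleftrightarrow> (?h has_integral J) {0..}" for J
    by (rule has_integral_spike_set_eq) (auto intro: negligible_subset[of "{0}"])
  ultimately have R: "(?h has_integral Beta (1 / 2) (r - 1 / 2) / 2) {0..}" by simp
  have "((\<lambda>x. \<bar>- 1\<bar> * ?h (- x)) has_integral Beta (1 / 2) (r - 1 / 2) / 2) {..0}"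
    by (subst has_integral_substitution_nonneg) (use R in \<open>auto intro!: derivative_eq_intros\<close>)
  then have L: "(?h has_integral Beta (1 / 2) (r - 1 / 2) / 2) {..0}" by simp
  have "(?h has_integral (Beta (1 / 2) (r - 1 / 2) / 2 + Beta (1 / 2) (r - 1 / 2) / 2)) ({..0} \<union> {0..})"
    by (intro has_integral_Un L R) (auto intro: negligible_subset[of "{0}"])
  moreover have "{..0} \<union> {0..} = (UNIV :: real set)" by auto
  ultimately show ?thesis by simp
qed

lemma nn_integral_horizontal_line:
  fixes r c h :: real
  assumes "r > 1 / 2" "h > 0"
  shows "(\<integral>\<^sup>+x. ennreal (((x - c)\<^sup>2 + h\<^sup>2) powr (- r)) \<partial>lborel)
    = ennreal (Beta (1 / 2) (r - 1 / 2) * h powr (1 - 2 * r))"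
proof -
  have "(\<integral>\<^sup>+x. ennreal (((x - c)\<^sup>2 + h\<^sup>2) powr (- r)) \<partial>lborel)
      = ennreal h * (\<integral>\<^sup>+x. ennreal ((((c + h * x) - c)\<^sup>2 + h\<^sup>2) powr (- r)) \<partial>lborel)"
    using assms by (subst nn_integral_real_affine[where c = h and t = c]) auto
  also have "(\<lambda>x. ennreal ((((c + h * x) - c)\<^sup>2 + h\<^sup>2) powr (- r)))
      = (\<lambda>x. ennreal (h powr (- 2 * r)) * ennreal ((1 + x\<^sup>2) powr (- r)))"
  proof
    fix x
    have "((c + h * x) - c)\<^sup>2 + h\<^sup>2 = h\<^sup>2 * (1 + x\<^sup>2)" by (simp add: algebra_simps)
    moreover have "(h\<^sup>2) powr (- r) = h powr (- 2 * r)"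
      using assms by (simp add: powr_powr flip: powr_numeral)
    ultimately show "ennreal ((((c + h * x) - c)\<^sup>2 + h\<^sup>2) powr (- r))
      = ennreal (h powr (- 2 * r)) * ennreal ((1 + x\<^sup>2) powr (- r))"
      by (simp add: powr_mult ennreal_mult)
  qed
  also have "(\<integral>\<^sup>+x. ennreal (h powr (- 2 * r)) * ennreal ((1 + x\<^sup>2) powr (- r)) \<partial>lborel)
      = ennreal (h powr (- 2 * r)) * ennreal (Beta (1 / 2) (r - 1 / 2))"
    using nn_integral_has_integral_lebesgue[OF _ has_integral_cauchy_power[OF assms(1)]]
    by (simp add: nn_integral_cmult)
  also have "ennreal h * (ennreal (h powr (- 2 * r)) * ennreal (Beta (1 / 2) (r - 1 / 2)))
      = ennreal (Beta (1 / 2) (r - 1 / 2) * h powr (1 - 2 * r))"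
  proof -
    have "h powr (1 - 2 * r) = h * h powr (- 2 * r)"
      using assms powr_add[of h 1 "- 2 * r"] by simp
    moreover have "Beta (1 / 2) (r - 1 / 2) \<ge> 0"
      using assms by (intro Beta_real_nonneg) auto
    ultimately show ?thesis
      using assms by (simp only: ennreal_mult[symmetric] powr_ge_zero mult_nonneg_nonneg less_imp_le) (simp only: mult_ac)
  qed
  finally show ?thesis .
qed

lemma nn_integral_vertical_ray:
  fixes a b h :: real
  assumes "a > 0" "b > 0" "h > 0"
  shows "(\<integral>\<^sup>+y. ennreal (y powr (a - 1) * (y + h) powr (- (a + b))) * indicator {0<..} y \<partial>lborel)
    = ennreal (Beta a b * h powr (- b))"
proof -
  have "(\<integral>\<^sup>+y. ennreal (y powr (a - 1) * (y + h) powr (- (a + b))) * indicator {0<..} y \<partial>lborel)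
      = ennreal h * (\<integral>\<^sup>+y. ennreal ((h * y) powr (a - 1) * (h * y + h) powr (- (a + b))) *
          indicator {0<..} (h * y) \<partial>lborel)"
    using assms by (subst nn_integral_real_affine[where c = h and t = 0]) auto
  also have "(\<lambda>y. ennreal ((h * y) powr (a - 1) * (h * y + h) powr (- (a + b))) *
          indicator {0<..} (h * y))
      = (\<lambda>y. ennreal (h powr (- b - 1)) *
          (indicator {0<..} y * ennreal (y powr (a - 1) * (1 + y) powr (- (a + b)))))"
  proof
    fix y
    show "ennreal ((h * y) powr (a - 1) * (h * y + h) powr (- (a + b))) * indicator {0<..} (h * y)
      = ennreal (h powr (- b - 1)) *
          (indicator {0<..} y * ennreal (y powr (a - 1) * (1 + y) powr (- (a + b))))"
    proof (cases "y > 0")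
      case True
      have "h * y + h = h * (1 + y)" by (simp add: algebra_simps)
      moreover have "h powr (a - 1) * h powr (- (a + b)) = h powr (- b - 1)"
        unfolding powr_add[symmetric] by (rule arg_cong[of _ _ "(powr) h"]) simp
      ultimately have "(h * y) powr (a - 1) * (h * y + h) powr (- (a + b))
          = h powr (- b - 1) * (y powr (a - 1) * (1 + y) powr (- (a + b)))"
        using True assms by (simp add: powr_mult mult_ac)
      then show ?thesis using True assms by (simp add: ennreal_mult')
    qed (use assms in \<open>simp add: zero_less_mult_iff\<close>)
  qed
  also have "(\<integral>\<^sup>+y. ennreal (h powr (- b - 1)) *
          (indicator {0<..} y * ennreal (y powr (a - 1) * (1 + y) powr (- (a + b)))) \<partial>lborel)
      = ennreal (h powr (- b - 1)) * ennreal (Beta a b)"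
  proof -
    have "(\<integral>\<^sup>+y. indicator {0<..} y * ennreal (y powr (a - 1) * (1 + y) powr (- (a + b))) \<partial>lborel)
        = (\<integral>\<^sup>+y. ennreal (indicator {0<..} y * (y powr (a - 1) * (1 + y) powr (- (a + b)))) \<partial>lborel)"
      by (intro nn_integral_cong) (simp add: indicator_def)
    also have "\<dots> = ennreal (Beta a b)"
      by (rule nn_integral_has_integral_lebesgue[OF _ has_integral_beta_prime[OF assms(1,2)]]) simp
    finally show ?thesis by (simp add: nn_integral_cmult)
  qed
  also have "ennreal h * (ennreal (h powr (- b - 1)) * ennreal (Beta a b))
      = ennreal (Beta a b * h powr (- b))"
  proof -
    have "h powr (- b) = h * h powr (- b - 1)"
      using assms powr_add[of h 1 "- b - 1"] by simp
    moreover have "Beta a b \<ge> 0"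
      using assms by (intro Beta_real_nonneg) auto
    ultimately show ?thesis
      using assms by (simp only: ennreal_mult[symmetric] powr_ge_zero mult_nonneg_nonneg less_imp_le) (simp only: mult_ac)
  qed
  finally show ?thesis .
qed

section \<open>The integral of the kernel function\<close>

lemma upper_halfplane_borel: "upper_halfplane \<in> sets borel"
  unfolding upper_halfplane_def by (intro borel_open open_halfspace_Im_gt)

text \<open>
  On the line of height \<open>y\<close> the distance to the reflected point \<open>cnj z\<^sub>0\<close> has vertical part
  \<open>y + Im z\<^sub>0\<close>. Integrating over \<open>x\<close> therefore leaves a power of \<open>y + Im z\<^sub>0\<close>, against which the
  weight in \<open>y\<close> is a Beta integral over the vertical ray.
\<close>
lemma nn_integral_halfplane_powr:
  fixes a r :: real
  assumes "a > 0" "2 * r - 1 - a > 0" "z\<^sub>0 \<in> upper_halfplane"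
  shows "(\<integral>\<^sup>+z\<in>upper_halfplane. ennreal (cmod (z - cnj z\<^sub>0) powr (- 2 * r) * Im z powr (a - 1)) \<partial>lborel)
    = ennreal (Beta (1 / 2) (r - 1 / 2) * Beta a (2 * r - 1 - a) * Im z\<^sub>0 powr (- (2 * r - 1 - a)))"
proof -
  let ?x0 = "Re z\<^sub>0" and ?y0 = "Im z\<^sub>0"
  let ?B = "Beta (1 / 2) (r - 1 / 2)"
  have y0: "?y0 > 0" using assms by (simp add: upper_halfplane_def)
  have B: "?B \<ge> 0"
    using assms by (intro Beta_real_nonneg) auto
  have "(\<integral>\<^sup>+z\<in>upper_halfplane. ennreal (cmod (z - cnj z\<^sub>0) powr (- 2 * r) * Im z powr (a - 1)) \<partial>lborel)
      = (\<integral>\<^sup>+y. \<integral>\<^sup>+x. ennreal (cmod (Complex x y - cnj z\<^sub>0) powr (- 2 * r) * y powr (a - 1)) *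
           indicator upper_halfplane (Complex x y) \<partial>lborel \<partial>lborel)"
    using upper_halfplane_borel by (subst nn_integral_lborel_complex) (measurable, simp_all)
  also have "\<dots> = (\<integral>\<^sup>+y. ennreal ?B *
      (ennreal (y powr (a - 1) * (y + ?y0) powr (- (a + (2 * r - 1 - a)))) * indicator {0<..} y) \<partial>lborel)"
  proof (rule nn_integral_cong)
    fix y :: real
    show "(\<integral>\<^sup>+x. ennreal (cmod (Complex x y - cnj z\<^sub>0) powr (- 2 * r) * y powr (a - 1)) *
           indicator upper_halfplane (Complex x y) \<partial>lborel)
      = ennreal ?B *
      (ennreal (y powr (a - 1) * (y + ?y0) powr (- (a + (2 * r - 1 - a)))) * indicator {0<..} y)"
    proof (cases "y > 0")
      case True
      have *: "cmod (Complex x y - cnj z\<^sub>0) powr (- 2 * r) = ((x - ?x0)\<^sup>2 + (y + ?y0)\<^sup>2) powr (- r)" for x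
        by (simp add: cmod_def powr_powr flip: powr_half_sqrt)
      have "(\<integral>\<^sup>+x. ennreal (cmod (Complex x y - cnj z\<^sub>0) powr (- 2 * r) * y powr (a - 1)) *
           indicator upper_halfplane (Complex x y) \<partial>lborel)
        = (\<integral>\<^sup>+x. ennreal (y powr (a - 1)) * ennreal (((x - ?x0)\<^sup>2 + (y + ?y0)\<^sup>2) powr (- r)) \<partial>lborel)"
        unfolding * using True by (simp add: upper_halfplane_def ennreal_mult mult.commute)
      also have "\<dots> = ennreal (y powr (a - 1)) * ennreal (?B * (y + ?y0) powr (1 - 2 * r))"
        using True y0 assms by (simp add: nn_integral_cmult nn_integral_horizontal_line)
      finally show ?thesis using True B by (simp add: ennreal_mult mult_ac)
    qed (simp add: upper_halfplane_def)
  qed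
  also have "\<dots> = ennreal ?B * ennreal (Beta a (2 * r - 1 - a) * ?y0 powr (- (2 * r - 1 - a)))"
    using nn_integral_vertical_ray[OF assms(1,2) y0] by (simp add: nn_integral_cmult)
  also have "\<dots> = ennreal (?B * Beta a (2 * r - 1 - a) * ?y0 powr (- (2 * r - 1 - a)))"
    using B by (simp add: mult.assoc flip: ennreal_mult')
  finally show ?thesis .
qed

lemma Gamma_legendre_duplication_real:
  fixes x :: real
  assumes "x > 0"
  shows "Gamma x * Gamma (x + 1 / 2) = 2 powr (1 - 2 * x) * sqrt pi * Gamma (2 * x)"
proof -
  have "complex_of_real x \<notin> \<int>\<^sub>\<le>\<^sub>0" "complex_of_real x + 1 / 2 \<notin> \<int>\<^sub>\<le>\<^sub>0"
    using assms by (auto simp: complex_eq_iff elim!: nonpos_Ints_cases)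
  from Gamma_legendre_duplication[OF this]
  have "complex_of_real (Gamma x * Gamma (x + 1 / 2))
      = of_real (exp ((1 - 2 * x) * ln 2) * sqrt pi * Gamma (2 * x))"
    by (simp flip: Gamma_complex_of_real exp_of_real)
  then have "Gamma x * Gamma (x + 1 / 2) = exp ((1 - 2 * x) * ln 2) * sqrt pi * Gamma (2 * x)"
    by (simp only: of_real_eq_iff)
  then show ?thesis by (simp add: powr_def)
qed

text \<open>
  The product is \<open>\<Gamma>(1/2) \<Gamma>(2s - 1/2) \<Gamma>(2s - 1) / \<Gamma>(4s - 1)\<close>. Duplication at \<open>2s - 1/2\<close> expresses
  \<open>\<Gamma>(2s - 1/2) \<Gamma>(2s) / \<Gamma>(4s - 1)\<close> by elementary functions, and \<open>\<Gamma>(2s - 1) / \<Gamma>(2s) = 1 / (2s - 1)\<close>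
  takes care of the rest.
\<close>
lemma Beta_half_times_Beta:
  fixes s :: real
  assumes "s > 1 / 2"
  shows "Beta (1 / 2) (2 * s - 1 / 2) * Beta (2 * s - 1) (2 * s)
    = pi * 2 powr (2 - 4 * s) / (2 * s - 1)"
proof -
  have pos: "Gamma (2 * s) > 0" "Gamma (2 * s - 1) > 0" "Gamma (4 * s - 1) > 0" "Gamma (2 * s - 1 / 2) > 0"
    using assms by (auto intro!: Gamma_real_pos)
  have dup: "Gamma (2 * s - 1 / 2) * Gamma (2 * s) = 2 powr (2 - 4 * s) * sqrt pi * Gamma (4 * s - 1)"
    using Gamma_legendre_duplication_real[of "2 * s - 1 / 2"] assms by (simp add: algebra_simps)
  have rec: "Gamma (2 * s) = (2 * s - 1) * Gamma (2 * s - 1)"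
  proof -
    have "2 * s - 1 \<notin> \<int>\<^sub>\<le>\<^sub>0"
      using assms by (auto dest!: nonpos_Ints_nonpos)
    then show ?thesis using Gamma_plus1[of "2 * s - 1"] by simp
  qed
  have "Beta (1 / 2) (2 * s - 1 / 2) * Beta (2 * s - 1) (2 * s)
      = sqrt pi * (Gamma (2 * s - 1 / 2) * Gamma (2 * s)) * Gamma (2 * s - 1) / (Gamma (2 * s) * Gamma (4 * s - 1))"
    by (simp add: Beta_def Gamma_one_half_real)
  also have "\<dots> = (sqrt pi * sqrt pi) * 2 powr (2 - 4 * s) * (Gamma (2 * s - 1) / Gamma (2 * s))"
    unfolding dup using pos by (simp add: field_simps)
  also have "Gamma (2 * s - 1) / Gamma (2 * s) = 1 / (2 * s - 1)"
    unfolding rec using pos(2) by simp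
  finally show ?thesis by simp
qed

lemma weighted_integral_bergman_kernel:
  fixes s :: real
  assumes "s > 1 / 2" "z\<^sub>0 \<in> upper_halfplane"
  shows "weighted_integral s (bergman_kernel z\<^sub>0)
    = ennreal (pi powr (1 - 2 * s) * 2 powr (2 - 4 * s) / (2 * s - 1) * Im z\<^sub>0 powr (- 2 * s))"
proof -
  note upper_halfplane_borel [measurable]
  let ?G = "\<lambda>z. ennreal (cmod (z - cnj z\<^sub>0) powr (- 2 * (2 * s)) * Im z powr ((2 * s - 1) - 1))"
  have "cmod (bergman_kernel z\<^sub>0 z) powr (2 * s)
      = pi powr (- 2 * s) * cmod (z - cnj z\<^sub>0) powr (- 2 * (2 * s))" for z
  proof -
    have "cmod (bergman_kernel z\<^sub>0 z) = inverse pi * cmod (z - cnj z\<^sub>0) powr (- 2)"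
      by (simp add: bergman_kernel_def norm_mult norm_divide norm_power_int powr_minus
          power_int_minus norm_inverse norm_power divide_inverse)
    then show ?thesis
      by (simp add: powr_mult powr_powr inverse_powr powr_minus flip: powr_powr)
  qed
  then have "weighted_integral s (bergman_kernel z\<^sub>0)
      = (\<integral>\<^sup>+z. ennreal (pi powr (- 2 * s)) * (?G z * indicator upper_halfplane z) \<partial>lborel)"
    unfolding weighted_integral_def by (simp add: ennreal_mult mult.assoc)
  also have "\<dots> = ennreal (pi powr (- 2 * s)) * (\<integral>\<^sup>+z\<in>upper_halfplane. ?G z \<partial>lborel)"
    by (intro nn_integral_cmult) measurable
  also have "(\<integral>\<^sup>+z\<in>upper_halfplane. ?G z \<partial>lborel)
      = ennreal (Beta (1 / 2) (2 * s - 1 / 2) * Beta (2 * s - 1) (2 * s) * Im z\<^sub>0 powr (- 2 * s))"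
    using assms by (subst nn_integral_halfplane_powr) auto
  also have "ennreal (pi powr (- 2 * s)) * \<dots>
      = ennreal (pi powr (1 - 2 * s) * 2 powr (2 - 4 * s) / (2 * s - 1) * Im z\<^sub>0 powr (- 2 * s))"
    unfolding Beta_half_times_Beta[OF assms(1)]
    by (simp add: powr_diff powr_minus field_simps flip: ennreal_mult')
  finally show ?thesis .
qed

section \<open>The quotient at the kernel function\<close>

text \<open>
  The weight is trivial for exponent 1, so that the weighted integral also computes the
  Bergman norm.
\<close>
lemma weighted_integral_1:
  "weighted_integral 1 F = (\<integral>\<^sup>+z\<in>upper_halfplane. ennreal ((cmod (F z))\<^sup>2) \<partial>lborel)"
  unfolding weighted_integral_def
  by (intro nn_integral_cong) (auto simp: upper_halfplane_def indicator_def powr_numeral)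

lemma has_bochner_integral_bergman_kernel_sq:
  assumes "z\<^sub>0 \<in> upper_halfplane"
  shows "has_bochner_integral lborel
    (\<lambda>z. indicator upper_halfplane z *\<^sub>R (cmod (bergman_kernel z\<^sub>0 z))\<^sup>2) (1 / (4 * pi * (Im z\<^sub>0)\<^sup>2))"
proof (rule has_bochner_integral_nn_integral)
  note upper_halfplane_borel [measurable]
  have [measurable]: "bergman_kernel z\<^sub>0 \<in> borel_measurable borel"
    unfolding bergman_kernel_def power_int_minus by simp
  show "(\<lambda>z. indicator upper_halfplane z *\<^sub>R (cmod (bergman_kernel z\<^sub>0 z))\<^sup>2) \<in> borel_measurable lborel"
    by measurable
  have "(\<integral>\<^sup>+z. ennreal (indicator upper_halfplane z *\<^sub>R (cmod (bergman_kernel z\<^sub>0 z))\<^sup>2) \<partial>lborel)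
      = weighted_integral 1 (bergman_kernel z\<^sub>0)"
    unfolding weighted_integral_1 by (intro nn_integral_cong) (auto simp: indicator_def)
  also have "\<dots> = ennreal (1 / (4 * pi * (Im z\<^sub>0)\<^sup>2))"
    using assms weighted_integral_bergman_kernel[of 1 z\<^sub>0]
    by (simp add: upper_halfplane_def powr_minus field_simps)
  finally show "(\<integral>\<^sup>+z. ennreal (indicator upper_halfplane z *\<^sub>R (cmod (bergman_kernel z\<^sub>0 z))\<^sup>2) \<partial>lborel)
      = ennreal (1 / (4 * pi * (Im z\<^sub>0)\<^sup>2))" .
qed auto

lemma bergman_kernel_in_bergman_space:
  assumes "z\<^sub>0 \<in> upper_halfplane"
  shows "bergman_kernel z\<^sub>0 \<in> bergman_space"
proof -
  have "z - cnj z\<^sub>0 \<noteq> 0" if "z \<in> upper_halfplane" for z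
    using that assms by (auto simp: upper_halfplane_def complex_eq_iff)
  then have "bergman_kernel z\<^sub>0 holomorphic_on upper_halfplane"
    unfolding bergman_kernel_def by (intro holomorphic_intros) auto
  then show ?thesis
    using has_bochner_integral_bergman_kernel_sq[OF assms]
    by (simp add: bergman_space_def set_integrable_def has_bochner_integral_iff)
qed

lemma bergman_norm_sq_bergman_kernel:
  assumes "z\<^sub>0 \<in> upper_halfplane"
  shows "bergman_norm_sq (bergman_kernel z\<^sub>0) = 1 / (4 * pi * (Im z\<^sub>0)\<^sup>2)"
  using has_bochner_integral_bergman_kernel_sq[OF assms]
  by (simp add: bergman_norm_sq_def set_lebesgue_integral_def has_bochner_integral_iff)

lemma bergman_quotient_bergman_kernel:
  fixes s :: real
  assumes "s > 1 / 2" "z\<^sub>0 \<in> upper_halfplane"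
  shows "bergman_quotient s (bergman_kernel z\<^sub>0)
    = ennreal (pi powr (1 - s) / ((2 * s - 1) * 2 powr (2 * s - 2)))"
proof -
  have y0: "Im z\<^sub>0 > 0" using assms by (simp add: upper_halfplane_def)
  have "(1 / (4 * pi * (Im z\<^sub>0)\<^sup>2)) powr s = 2 powr (- 2 * s) * pi powr (- s) * Im z\<^sub>0 powr (- 2 * s)"
  proof -
    have "(4::real) powr s = 2 powr (2 * s)"
      using powr_powr[of 2 2 s] by simp
    moreover have "((Im z\<^sub>0)\<^sup>2) powr s = Im z\<^sub>0 powr (2 * s)"
      using y0 powr_powr[of "Im z\<^sub>0" 2 s] by (simp add: powr_numeral)
    ultimately show ?thesis
      using y0 by (simp add: powr_divide powr_mult powr_minus field_simps)
  qed
  moreover have "pi powr (1 - 2 * s) = pi powr (1 - s) * pi powr (- s)"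
    "(2::real) powr (2 - 4 * s) = 2 powr (- 2 * s) / 2 powr (2 * s - 2)"
    by (simp_all flip: powr_add powr_diff)
  ultimately show ?thesis
    using assms y0
    by (simp add: bergman_quotient_def weighted_integral_bergman_kernel
        bergman_norm_sq_bergman_kernel divide_ennreal)
qed

section \<open>Maximality\<close>

text \<open>
  Division in \<open>[0, \<infinity>]\<close> by a vanishing norm is harmless: the hypothesis then forces the numerator
  to vanish as well, and \<open>0 / 0 = 0\<close> there.
\<close>
lemma bergman_quotient_le:
  fixes s :: real
  assumes "weighted_integral s F \<le> ennreal (C * bergman_norm_sq F powr s)" "C \<ge> 0"
  shows "bergman_quotient s F \<le> ennreal C"
proof (cases "bergman_norm_sq F powr s = 0")
  case True
  with assms have "weighted_integral s F = 0" by simp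
  then show ?thesis by (simp add: bergman_quotient_def)
next
  case False
  then have pos: "bergman_norm_sq F powr s > 0" by simp
  have "bergman_quotient s F \<le> ennreal (C * bergman_norm_sq F powr s) / ennreal (bergman_norm_sq F powr s)"
    unfolding bergman_quotient_def by (intro divide_right_mono_ennreal assms)
  also have "\<dots> = ennreal C"
    using pos assms by (simp add: divide_ennreal)
  finally show ?thesis .
qed

theorem corollary1p4:
  assumes "lieb_solovej_conjecture"
  shows "\<forall>s::real. s > 1 \<longrightarrow> (\<forall>z\<^sub>0\<in>upper_halfplane.
    is_arg_max (bergman_quotient s)
      (\<lambda>F. F \<in> bergman_space \<and> (\<exists>z\<in>upper_halfplane. F z \<noteq> 0))
      (bergman_kernel z\<^sub>0))"
proof (intro allI impI ballI)
  fix s :: real and z\<^sub>0 assume s: "s > 1" and z0: "z\<^sub>0 \<in> upper_halfplane"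
  have le: "bergman_quotient s F \<le> bergman_quotient s (bergman_kernel z\<^sub>0)" if "F \<in> bergman_space" for F
  proof -
    have "bergman_quotient s F \<le> ennreal (pi powr (1 - s) / ((2 * s - 1) * 2 powr (2 * s - 2)))"
      using assms s that unfolding lieb_solovej_conjecture_def by (intro bergman_quotient_le) auto
    also have "\<dots> = bergman_quotient s (bergman_kernel z\<^sub>0)"
      using s z0 by (simp add: bergman_quotient_bergman_kernel)
    finally show ?thesis .
  qed
  have "z\<^sub>0 - cnj z\<^sub>0 \<noteq> 0"
    using z0 by (auto simp: upper_halfplane_def complex_eq_iff)
  then have "bergman_kernel z\<^sub>0 z\<^sub>0 \<noteq> 0"
    by (simp add: bergman_kernel_def)
  then show "is_arg_max (bergman_quotient s)
      (\<lambda>F. F \<in> bergman_space \<and> (\<exists>z\<in>upper_halfplane. F z \<noteq> 0)) (bergman_kernel z\<^sub>0)"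
    using le z0 bergman_kernel_in_bergman_space[OF z0]
    by (auto simp: is_arg_max_def not_less)
qed

end
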